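(* Let $n\ge2$. There exists $A\in\mathbb{C}^{n\times n}$ that cannot be expressed as a product of $r$ persymmetric Hankel matrices for any $r\in\mathbb{N}$.
   Context: All factors are $n\times n$ with complex entries. A matrix $(x_{ij})$ is Hankel if $x_{ij}$ depends only on $i+j$. An $n\times n$ matrix $X=(x_{ij})$ is persymmetric if $x_{ij}=x_{n-j+1,n-i+1}$ for all $1\le i,j\le n$. *)

theory Defs
  imports Complex_Main "Jordan_Normal_Form.Matrix"
begin

definition hankel_mat :: "'a mat \<Rightarrow> bool" where
  "hankel_mat X \<longleftrightarrow>
     (\<forall>i j k l. i < dim_row X \<and> j < dim_col X \<and> k < dim_row X \<and> l < dim_col X \<and> i + j = k + l
        \<longrightarrow> X $$ (i, j) = X $$ (k, l))"

(* Indices of mat start at 0, so the reflection i |-> n - i + 1 of {1..n}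
   becomes i |-> n - 1 - i on {0..<n}. *)
definition persymmetric_mat :: "'a mat \<Rightarrow> bool" where
  "persymmetric_mat X \<longleftrightarrow> square_mat X \<and>
     (\<forall>i j. i < dim_row X \<and> j < dim_row X
        \<longrightarrow> X $$ (i, j) = X $$ (dim_row X - 1 - j, dim_row X - 1 - i))"

(* Ordered product X1 * (X2 * ...) of a list of n x n matrices. The size is passed
   explicitly because the empty product is the n x n identity. *)
definition mat_prod_list :: "nat \<Rightarrow> 'a :: semiring_1 mat list \<Rightarrow> 'a mat" where
  "mat_prod_list n Xs = foldr (*) Xs (1\<^sub>m n)"

end

theory Submission
  imports Defs
begin

text \<open>
  In a Hankel matrix exchanging the two indices changes nothing, so persymmetry (reflection in the
  antidiagonal) becomes invariance under rotation by 180 degrees. Equivalently, a persymmetric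
  Hankel matrix commutes with the exchange matrix, the permutation matrix that reverses the order
  of the standard basis. Matrices that commute with a fixed matrix form a subalgebra, so products
  of any length stay inside this proper subspace. The matrix unit with its single 1 in the top
  left corner lies outside it as soon as \<open>n \<ge> 2\<close>, since the rotation moves that 1 to the bottom
  right corner.
\<close>

definition centrosymmetric_mat :: "nat \<Rightarrow> 'a mat \<Rightarrow> bool" where
  "centrosymmetric_mat n X \<longleftrightarrow> X \<in> carrier_mat n n \<and>
     (\<forall>i < n. \<forall>j < n. X $$ (n - 1 - i, n - 1 - j) = X $$ (i, j))"

lemma centrosymmetric_mat_if_persymmetric_hankel:
  assumes X: "X \<in> carrier_mat n n" and p: "persymmetric_mat X" and h: "hankel_mat X"
  shows "centrosymmetric_mat n X"
  unfolding centrosymmetric_mat_def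
proof (intro conjI allI impI)
  fix i j assume ij: "i < n" "j < n"
  have "X $$ (n - 1 - i, n - 1 - j) = X $$ (n - 1 - j, n - 1 - i)"
    using h[unfolded hankel_mat_def, rule_format,
        of "n - 1 - i" "n - 1 - j" "n - 1 - j" "n - 1 - i"] X ij by simp
  also have "\<dots> = X $$ (i, j)"
    using p[unfolded persymmetric_mat_def, THEN conjunct2, rule_format, of i j] X ij by simp
  finally show "X $$ (n - 1 - i, n - 1 - j) = X $$ (i, j)" .
qed (fact X)

lemma centrosymmetric_mat_one: "centrosymmetric_mat n (1\<^sub>m n)"
  by (auto simp: centrosymmetric_mat_def)

text \<open>
  Reversing the summation index in the entry formula for the product turns the rotated entry into
  the original one; this is the entrywise form of closure of a commutant under multiplication.
\<close>

lemma centrosymmetric_mat_mult: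
  fixes X Y :: "'a :: semiring_0 mat"
  assumes "centrosymmetric_mat n X" and "centrosymmetric_mat n Y"
  shows "centrosymmetric_mat n (X * Y)"
proof -
  have X: "X \<in> carrier_mat n n" and Y: "Y \<in> carrier_mat n n"
    using assms by (auto simp: centrosymmetric_mat_def)
  have entry: "(X * Y) $$ (i, j) = (\<Sum>k<n. X $$ (i, k) * Y $$ (k, j))"
    if "i < n" "j < n" for i j
    using X Y that by (auto simp: scalar_prod_def lessThan_atLeast0 intro!: sum.cong)
  have "(X * Y) $$ (n - 1 - i, n - 1 - j) = (X * Y) $$ (i, j)" if ij: "i < n" "j < n" for i j
  proof -
    have "(X * Y) $$ (n - 1 - i, n - 1 - j)
        = (\<Sum>k<n. X $$ (n - 1 - i, k) * Y $$ (k, n - 1 - j))"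
      using ij by (intro entry) auto
    also have "\<dots> = (\<Sum>k<n. X $$ (n - 1 - i, n - 1 - k) * Y $$ (n - 1 - k, n - 1 - j))"
      using sum.nat_diff_reindex[of "\<lambda>k. X $$ (n - 1 - i, k) * Y $$ (k, n - 1 - j)" n]
      by simp
    also have "\<dots> = (\<Sum>k<n. X $$ (i, k) * Y $$ (k, j))"
      using assms ij unfolding centrosymmetric_mat_def by (intro sum.cong) auto
    also have "\<dots> = (X * Y) $$ (i, j)"
      using entry ij by simp
    finally show ?thesis .
  qed
  then show ?thesis
    using X Y by (auto simp: centrosymmetric_mat_def)
qed

lemma centrosymmetric_mat_prod_list:
  assumes "\<And>X. X \<in> set Xs \<Longrightarrow> centrosymmetric_mat n X"
  shows "centrosymmetric_mat n (mat_prod_list n Xs)"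
  using assms unfolding mat_prod_list_def
  by (induction Xs) (simp_all add: centrosymmetric_mat_one centrosymmetric_mat_mult)

theorem corollary6p3:
  fixes n :: nat
  assumes "n \<ge> 2"
  shows "\<exists>A \<in> carrier_mat n n. \<forall>r::nat.
    \<not> (\<exists>Xs :: complex mat list. length Xs = r \<and>
         (\<forall>X \<in> set Xs. X \<in> carrier_mat n n \<and> persymmetric_mat X \<and> hankel_mat X) \<and>
         A = mat_prod_list n Xs)"
proof -
  define A :: "complex mat" where "A = mat n n (\<lambda>ij. if ij = (0, 0) then 1 else 0)"
  have A: "A \<in> carrier_mat n n"
    by (simp add: A_def)
  have "A $$ (n - 1 - 0, n - 1 - 0) \<noteq> A $$ (0, 0)"
    using assms by (simp add: A_def)
  then have "\<not> centrosymmetric_mat n A"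
    using assms unfolding centrosymmetric_mat_def by force
  then have "A \<noteq> mat_prod_list n Xs"
    if "\<forall>X \<in> set Xs. X \<in> carrier_mat n n \<and> persymmetric_mat X \<and> hankel_mat X" for Xs
    using that centrosymmetric_mat_prod_list centrosymmetric_mat_if_persymmetric_hankel by blast
  with A show ?thesis
    by blast
qed

end
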